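(* Let $d\ge 1$, $q\ge 0$, let $\Omega\subseteq\mathbf{R}^d$ be a region and $w\ge 0$ a suitable weight function on $\Omega$. Let $n=\binom{d+q}{d}=\dim\mathcal{P}_q$, let $\{e_a\}_{a=1}^n$ be an arbitrary orthonormal basis of $\mathcal{P}_q$, and let the $n\times n$ matrices $A_1,\dots,A_d$ be the representations of the operators $\chi_1,\dots,\chi_d$ in this basis, i.e. $(A_i)_{ab}=\langle e_a|\chi_i e_b\rangle$. Suppose that for the region $\Omega$ and weight function $w$ there is a degree $2q+1$, $N$-point cubature rule with positive weights. Then there exist $N\times N$ symmetric commuting extensions of $A_1,\dots,A_d$.
   Context: All matrices are real. "Suitable" weight: $\Omega\subseteq\mathbf{R}^d$ and $w:\Omega\to[0,\infty)$ are measurable, $\int_\Omega w(x)|p(x)|\,d^dx<\infty$ for every polynomial $p$, and $\int_\Omega w(x)p(x)^2\,d^dx>0$ for every nonzero polynomial $p$. $\mathcal{P}_m$ is the real vector space of polynomials in $x_1,\dots,x_d$ of total degree at most $m$, with inner product $\langle a|b\rangle=\int_\Omega w(x)a(x)b(x)\,d^dx$. $\Pi_q:\mathcal{P}_{q+1}\to\mathcal{P}_q$ is the orthogonal projection with respect to this inner product, and $\chi_i:\mathcal{P}_q\to\mathcal{P}_q$ is defined by $\chi_i p=\Pi_q(x_i p)$; equivalently $\langle a|\chi_i b\rangle=\int_\Omega w(x)a(x)x_ib(x)\,d^dx$ for $a,b\in\mathcal{P}_q$. An $N$-point cubature rule with positive weights, $\int_\Omega w(x)f(x)\,d^dx\approx\sum_{\alpha=1}^N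 w_\alpha f(x_\alpha)$, consists of nodes $x_\alpha\in\mathbf{R}^d$ and weights $w_\alpha>0$, $\alpha=1,\dots,N$. It is of degree $D$ if it is exact (equality holds) for every polynomial $f$ of total degree at most $D$ and non-exact for at least one polynomial of total degree $D+1$. $N\times N$ matrices $\tilde A_1,\dots,\tilde A_d$ are commuting extensions of the $n\times n$ matrices $A_1,\dots,A_d$ ($N\ge n$) if the top left $n\times n$ block of $\tilde A_i$ is $A_i$ for each $i$, and the $\tilde A_i$ pairwise commute. They are symmetric commuting extensions if moreover every $\tilde A_i$ is symmetric. *)

theory Defs
  imports "HOL-Analysis.Analysis" "Jordan_Normal_Form.Matrix"
begin

no_notation vec_index (infixl "$" 100)

text \<open>
  Polynomials in \<open>d = CARD('d)\<close> real variables are represented by their polynomial functions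
  \<open>real ^ 'd \<Rightarrow> real\<close>, which is harmless because \<open>\<real>\<close> is infinite; monomials are indexed by
  exponent functions \<open>k :: 'd \<Rightarrow> nat\<close>.
\<close>

definition monomial_fun :: "('d::finite \<Rightarrow> nat) \<Rightarrow> real ^ 'd \<Rightarrow> real" where
  "monomial_fun k x = (\<Prod>i\<in>UNIV. (x $ i) ^ k i)"

definition poly_space :: "nat \<Rightarrow> (real ^ 'd::finite \<Rightarrow> real) set" where
  "poly_space m = {p. \<exists>c. p = (\<lambda>x. \<Sum>k | (\<Sum>i\<in>UNIV. k i) \<le> m. c k * monomial_fun k x)}"

lemma finite_multi_indices: "finite {k :: 'd::finite \<Rightarrow> nat. (\<Sum>i\<in>UNIV. k i) \<le> m}"
proof (rule finite_subset)
  show "{k :: 'd \<Rightarrow> nat. (\<Sum>i\<in>UNIV. k i) \<le> m} \<subseteq> Pi\<^sub>E UNIV (\<lambda>_. {..m})"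
  proof (clarsimp simp: PiE_UNIV_domain)
    fix k :: "'d \<Rightarrow> nat" and i
    assume "(\<Sum>i\<in>UNIV. k i) \<le> m"
    then show "k i \<le> m"
      using member_le_sum[of i UNIV k] by simp
  qed
qed (simp add: finite_PiE)

lemma poly_space_monomial:
  fixes k :: "'d::finite \<Rightarrow> nat"
  assumes "(\<Sum>i\<in>UNIV. k i) \<le> m"
  shows "(\<lambda>x. a * monomial_fun k x) \<in> poly_space m"
proof -
  have "(\<lambda>x. a * monomial_fun k x) =
    (\<lambda>x. \<Sum>k' | (\<Sum>i\<in>UNIV. k' i) \<le> m. (if k' = k then a else 0) * monomial_fun k' x)"
    using assms by (simp add: if_distrib[of "\<lambda>z. z * _"] sum.delta finite_multi_indices cong: if_cong)
  then show ?thesis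
    unfolding poly_space_def by (intro CollectI exI[of _ "\<lambda>k'. if k' = k then a else 0"])
qed

lemma poly_space_add:
  assumes "p \<in> poly_space m" "r \<in> poly_space m"
  shows "(\<lambda>x. p x + r x) \<in> poly_space m"
proof -
  obtain c c' where
    "p = (\<lambda>x. \<Sum>k | (\<Sum>i\<in>UNIV. k i) \<le> m. c k * monomial_fun k x)"
    "r = (\<lambda>x. \<Sum>k | (\<Sum>i\<in>UNIV. k i) \<le> m. c' k * monomial_fun k x)"
    using assms unfolding poly_space_def by blast
  then have "(\<lambda>x. p x + r x) =
    (\<lambda>x. \<Sum>k | (\<Sum>i\<in>UNIV. k i) \<le> m. (c k + c' k) * monomial_fun k x)"
    by (simp add: sum.distrib distrib_right)
  then show ?thesis
    unfolding poly_space_def by (intro CollectI exI)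
qed

lemma poly_space_sum:
  assumes "finite I" "\<And>j. j \<in> I \<Longrightarrow> f j \<in> poly_space m"
  shows "(\<lambda>x. \<Sum>j\<in>I. f j x) \<in> poly_space m"
  using assms
proof (induction I rule: finite_induct)
  case empty
  then show ?case
    using poly_space_monomial[of "\<lambda>_. 0" m 0] by simp
next
  case (insert j I)
  then show ?case
    using poly_space_add[of "f j" m "\<lambda>x. \<Sum>j\<in>I. f j x"] by simp
qed

lemma poly_space_mono:
  assumes "p \<in> poly_space m" "m \<le> m'"
  shows "p \<in> poly_space m'"
proof -
  obtain c where p: "p = (\<lambda>x. \<Sum>k | (\<Sum>i\<in>UNIV. k i) \<le> m. c k * monomial_fun k x)"
    using assms unfolding poly_space_def by blast
  show ?thesis
    unfolding p using assms(2) by (intro poly_space_sum finite_multi_indices poly_space_monomial) auto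
qed

lemma poly_space_mult:
  assumes "p \<in> poly_space m" "r \<in> poly_space m'"
  shows "(\<lambda>x. p x * r x) \<in> poly_space (m + m')"
proof -
  obtain c c' where p:
    "p = (\<lambda>x. \<Sum>k | (\<Sum>i\<in>UNIV. k i) \<le> m. c k * monomial_fun k x)"
    "r = (\<lambda>x. \<Sum>k | (\<Sum>i\<in>UNIV. k i) \<le> m'. c' k * monomial_fun k x)"
    using assms unfolding poly_space_def by blast
  have "(\<lambda>x. p x * r x) = (\<lambda>x. \<Sum>k | (\<Sum>i\<in>UNIV. k i) \<le> m. \<Sum>k' | (\<Sum>i\<in>UNIV. k' i) \<le> m'.
      (c k * c' k') * monomial_fun (\<lambda>i. k i + k' i) x)"
    unfolding p sum_product
    by (simp add: monomial_fun_def power_add prod.distrib mult_ac)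
  also have "\<dots> \<in> poly_space (m + m')"
    by (intro poly_space_sum finite_multi_indices poly_space_monomial)
       (auto simp: sum.distrib add_mono)
  finally show ?thesis .
qed

lemma poly_space_coordinate:
  fixes i :: "'d::finite"
  shows "(\<lambda>x. a * x $ i) \<in> poly_space 1"
proof -
  have "monomial_fun (\<lambda>j. if j = i then 1 else 0) x = x $ i" for x :: "real ^ 'd"
    by (simp add: monomial_fun_def if_distrib[of "\<lambda>z. _ ^ z"] prod.delta cong: if_cong)
  then show ?thesis
    using poly_space_monomial[of "\<lambda>j. if j = i then 1 else 0" 1 a] by simp
qed

lemma real_polynomial_function_sum':
  assumes "finite I" "\<And>j. j \<in> I \<Longrightarrow> real_polynomial_function (f j)"
  shows "real_polynomial_function (\<lambda>x. \<Sum>j\<in>I. f j x)"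
  using assms by (induction I rule: finite_induct) auto

lemma real_polynomial_function_monomial: "real_polynomial_function (monomial_fun k)"
proof -
  have "real_polynomial_function (\<lambda>x. \<Prod>i\<in>I. (x $ i) ^ k i)" if "finite I" for I
    using that
  proof (induction I rule: finite_induct)
    case (insert i I)
    have "real_polynomial_function (\<lambda>x::real^'a. x $ i)"
      by (simp add: real_polynomial_function.intros(1) bounded_linear_vec_nth)
    then have "real_polynomial_function (\<lambda>x::real^'a. (x $ i) ^ k i)"
      by (rule real_polynomial_function_power)
    with insert show ?case
      by (simp add: real_polynomial_function.intros(4))
  qed (simp add: real_polynomial_function.intros(2))
  then show ?thesis
    by (simp add: monomial_fun_def[abs_def])
qed

lemma real_polynomial_function_iff_poly_space:
  fixes p :: "real ^ 'd::finite \<Rightarrow> real"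
  shows "real_polynomial_function p \<longleftrightarrow> (\<exists>m. p \<in> poly_space m)"
proof
  assume "real_polynomial_function p"
  then show "\<exists>m. p \<in> poly_space m"
  proof (induction rule: real_polynomial_function.induct)
    case (linear f)
    then have "f x = (\<Sum>i\<in>UNIV. f (axis i 1) * x $ i)" for x :: "real ^ 'd"
    proof -
      have lin: "Real_Vector_Spaces.linear f"
        using linear by (rule bounded_linear.linear)
      have "f x = f (\<Sum>i\<in>UNIV. x $ i *\<^sub>R axis i 1)"
        by (simp add: basis_expansion flip: scalar_mult_eq_scaleR)
      also have "\<dots> = (\<Sum>i\<in>UNIV. f (axis i 1) * x $ i)"
        by (simp add: linear_sum[OF lin] linear_scale[OF lin] mult.commute)
      finally show ?thesis .
    qed
    then have "f = (\<lambda>x. \<Sum>i\<in>UNIV. f (axis i 1) * x $ i)"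
      by blast
    moreover have "(\<lambda>x. \<Sum>i\<in>UNIV. f (axis i 1) * x $ i) \<in> poly_space 1"
      by (intro poly_space_sum poly_space_coordinate) simp
    ultimately show ?case
      by metis
  next
    case (const c)
    show ?case
      using poly_space_monomial[of "\<lambda>_. 0" 0 c] by (auto simp: monomial_fun_def)
  next
    case (add f g)
    then obtain m m' where "f \<in> poly_space m" "g \<in> poly_space m'"
      by blast
    then have "(\<lambda>x. f x + g x) \<in> poly_space (max m m')"
      by (intro poly_space_add) (auto elim: poly_space_mono)
    then show ?case ..
  next
    case (mult f g)
    then show ?case
      using poly_space_mult by blast
  qed
next
  assume "\<exists>m. p \<in> poly_space m"
  then obtain m c where p: "p = (\<lambda>x. \<Sum>k | (\<Sum>i\<in>UNIV. k i) \<le> m. c k * monomial_fun k x)"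
    unfolding poly_space_def by blast
  show "real_polynomial_function p"
    unfolding p
    by (intro real_polynomial_function_sum' finite_multi_indices real_polynomial_function.intros(4)
        real_polynomial_function.intros(2) real_polynomial_function_monomial)
qed

text \<open>Only the values of \<open>w\<close> on \<open>\<Omega>\<close> matter below.\<close>

definition suitable_weight :: "(real ^ 'd::finite) set \<Rightarrow> (real ^ 'd \<Rightarrow> real) \<Rightarrow> bool" where
  "suitable_weight \<Omega> w \<longleftrightarrow>
     \<Omega> \<in> sets lebesgue \<and>
     w \<in> borel_measurable (lebesgue_on \<Omega>) \<and>
     (\<forall>x\<in>\<Omega>. 0 \<le> w x) \<and>
     (\<forall>p. real_polynomial_function p \<longrightarrow> integrable (lebesgue_on \<Omega>) (\<lambda>x. w x * \<bar>p x\<bar>)) \<and>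
     (\<forall>p. real_polynomial_function p \<and> p \<noteq> (\<lambda>_. 0) \<longrightarrow>
        0 < (\<integral>x. w x * (p x)\<^sup>2 \<partial>lebesgue_on \<Omega>))"

definition weighted_inner ::
  "(real ^ 'd::finite) set \<Rightarrow> (real ^ 'd \<Rightarrow> real) \<Rightarrow> (real ^ 'd \<Rightarrow> real) \<Rightarrow> (real ^ 'd \<Rightarrow> real) \<Rightarrow> real"
  where "weighted_inner \<Omega> w a b = (\<integral>x. w x * a x * b x \<partial>lebesgue_on \<Omega>)"

definition is_orthonormal_basis ::
  "(real ^ 'd::finite) set \<Rightarrow> (real ^ 'd \<Rightarrow> real) \<Rightarrow> nat \<Rightarrow> nat \<Rightarrow> (nat \<Rightarrow> real ^ 'd \<Rightarrow> real) \<Rightarrow> bool"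
  where "is_orthonormal_basis \<Omega> w q n e \<longleftrightarrow>
     (\<forall>a<n. e a \<in> poly_space q) \<and>
     (\<forall>a<n. \<forall>b<n. weighted_inner \<Omega> w (e a) (e b) = (if a = b then 1 else 0)) \<and>
     (\<forall>p\<in>poly_space q. \<exists>c. p = (\<lambda>x. \<Sum>a<n. c a * e a x))"

text \<open>The orthogonal projection of \<open>poly_space (q + 1)\<close> onto \<open>poly_space q\<close>; for a suitable
  weight the described polynomial exists and is unique.\<close>

definition poly_proj ::
  "(real ^ 'd::finite) set \<Rightarrow> (real ^ 'd \<Rightarrow> real) \<Rightarrow> nat \<Rightarrow> (real ^ 'd \<Rightarrow> real) \<Rightarrow> real ^ 'd \<Rightarrow> real"
  where "poly_proj \<Omega> w q p =
     (THE r. r \<in> poly_space q \<and>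
        (\<forall>a\<in>poly_space q. weighted_inner \<Omega> w a (\<lambda>x. p x - r x) = 0))"

definition chi_op ::
  "(real ^ 'd::finite) set \<Rightarrow> (real ^ 'd \<Rightarrow> real) \<Rightarrow> nat \<Rightarrow> 'd \<Rightarrow> (real ^ 'd \<Rightarrow> real) \<Rightarrow> real ^ 'd \<Rightarrow> real"
  where "chi_op \<Omega> w q i p = poly_proj \<Omega> w q (\<lambda>x. x $ i * p x)"

definition cubature_exact ::
  "(real ^ 'd::finite) set \<Rightarrow> (real ^ 'd \<Rightarrow> real) \<Rightarrow> nat \<Rightarrow> (nat \<Rightarrow> real ^ 'd) \<Rightarrow> (nat \<Rightarrow> real) \<Rightarrow>
   (real ^ 'd \<Rightarrow> real) \<Rightarrow> bool"
  where "cubature_exact \<Omega> w N node weight f \<longleftrightarrow>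
     (\<integral>x. w x * f x \<partial>lebesgue_on \<Omega>) = (\<Sum>\<alpha><N. weight \<alpha> * f (node \<alpha>))"

text \<open>The nodes are required neither to be distinct nor to lie in \<open>\<Omega>\<close>.\<close>

definition is_positive_cubature_rule ::
  "(real ^ 'd::finite) set \<Rightarrow> (real ^ 'd \<Rightarrow> real) \<Rightarrow> nat \<Rightarrow> nat \<Rightarrow> (nat \<Rightarrow> real ^ 'd) \<Rightarrow>
   (nat \<Rightarrow> real) \<Rightarrow> bool"
  where "is_positive_cubature_rule \<Omega> w D N node weight \<longleftrightarrow>
     (\<forall>\<alpha><N. 0 < weight \<alpha>) \<and>
     (\<forall>f\<in>poly_space D. cubature_exact \<Omega> w N node weight f) \<and>
     (\<exists>f\<in>poly_space (D + 1) - poly_space D. \<not> cubature_exact \<Omega> w N node weight f)"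

definition commuting_extensions ::
  "nat \<Rightarrow> nat \<Rightarrow> ('i \<Rightarrow> real mat) \<Rightarrow> ('i \<Rightarrow> real mat) \<Rightarrow> bool" where
  "commuting_extensions n N A A' \<longleftrightarrow>
     n \<le> N \<and>
     (\<forall>i. A i \<in> carrier_mat n n) \<and>
     (\<forall>i. A' i \<in> carrier_mat N N) \<and>
     (\<forall>i. \<forall>a<n. \<forall>b<n. A' i $$ (a, b) = A i $$ (a, b)) \<and>
     (\<forall>i j. A' i * A' j = A' j * A' i)"

definition symmetric_commuting_extensions ::
  "nat \<Rightarrow> nat \<Rightarrow> ('i \<Rightarrow> real mat) \<Rightarrow> ('i \<Rightarrow> real mat) \<Rightarrow> bool" where
  "symmetric_commuting_extensions n N A A' \<longleftrightarrow>
     commuting_extensions n N A A' \<and> (\<forall>i. transpose_mat (A' i) = A' i)"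

end

theory Submission
  imports Defs
begin

text \<open>
  Exactness in degree \<open>2 q + 1\<close> turns the inner products \<open>\<langle>e\<^sub>a | e\<^sub>b\<rangle>\<close> and \<open>\<langle>e\<^sub>a | x\<^sub>i e\<^sub>b\<rangle>\<close> into sums
  over the nodes. Hence the vectors \<open>v\<^sub>a \<in> \<real>\<^sup>N\<close> with entries \<open>sqrt w\<^sub>\<alpha> * e\<^sub>a x\<^sub>\<alpha>\<close> are orthonormal, so
  \<open>n \<le> N\<close>. After completing them to the rows of an orthogonal matrix \<open>U\<close>, the extensions are
  \<open>U D\<^sub>i U\<^sup>T\<close>, where \<open>D\<^sub>i\<close> is the diagonal matrix of the \<open>i\<close>-th coordinates of the nodes.

  For \<open>k\<close> orthonormal vectors in \<open>\<real>\<^sup>N\<close>, the squared norms of the residuals of the \<open>N\<close> standard basis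
  vectors sum to the trace \<open>N - k\<close> of the complementary projection. This one identity gives
  \<open>k \<le> N\<close>, a nonzero residual to adjoin when \<open>k < N\<close>, and orthonormal columns when \<open>k = N\<close>.
\<close>

section \<open>Orthonormal vectors in N-dimensional space and their completion to a basis\<close>

definition orthonormal_family :: "nat \<Rightarrow> nat \<Rightarrow> (nat \<Rightarrow> nat \<Rightarrow> real) \<Rightarrow> bool" where
  "orthonormal_family N k v \<longleftrightarrow>
     (\<forall>a<k. \<forall>b<k. (\<Sum>\<alpha><N. v a \<alpha> * v b \<alpha>) = (if a = b then 1 else 0))"

text \<open>For an orthonormal family this is coordinate \<open>\<beta>\<close> of the standard
  basis vector \<open>\<alpha>\<close> minus its projection onto the span; as a matrix, I - V^T V
  where V has rows \<open>v a\<close>.\<close>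

definition residual :: "nat \<Rightarrow> (nat \<Rightarrow> nat \<Rightarrow> real) \<Rightarrow> nat \<Rightarrow> nat \<Rightarrow> real" where
  "residual k v \<alpha> \<beta> = (if \<alpha> = \<beta> then 1 else 0) - (\<Sum>a<k. v a \<alpha> * v a \<beta>)"

text \<open>Pairing \<open>v a\<close> with the standard basis vector and with its projection gives
  the same number, \<open>v a \<alpha>\<close>.\<close>

lemma residual_orthogonal:
  assumes "orthonormal_family N k v" "\<alpha> < N" "a < k"
  shows "(\<Sum>\<beta><N. v a \<beta> * residual k v \<alpha> \<beta>) = 0"
proof -
  have "(\<Sum>\<beta><N. v a \<beta> * (\<Sum>b<k. v b \<alpha> * v b \<beta>)) = (\<Sum>b<k. v b \<alpha> * (\<Sum>\<beta><N. v a \<beta> * v b \<beta>))"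
    unfolding sum_distrib_left by (subst sum.swap) (simp add: mult_ac)
  also have "\<dots> = (\<Sum>b<k. v b \<alpha> * (if a = b then 1 else 0))"
    using assms by (intro sum.cong) (auto simp: orthonormal_family_def)
  also have "\<dots> = v a \<alpha>"
    using assms(3) by (simp add: if_distrib sum.delta cong: if_cong)
  finally have "(\<Sum>\<beta><N. v a \<beta> * (\<Sum>b<k. v b \<alpha> * v b \<beta>)) = v a \<alpha>" .
  moreover have "(\<Sum>\<beta><N. v a \<beta> * (if \<alpha> = \<beta> then 1 else 0)) = v a \<alpha>"
    using assms(2) by (simp add: if_distrib sum.delta cong: if_cong)
  ultimately show ?thesis
    by (simp add: residual_def right_diff_distrib sum_subtractf)
qed

text \<open>The part subtracted in one factor is a combination of the \<open>v a\<close>, hence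
  orthogonal to the residual; only the diagonal entry \<open>residual k v \<alpha> \<alpha>\<close>
  survives.\<close>

lemma residual_norm:
  assumes "orthonormal_family N k v" "\<alpha> < N"
  shows "(\<Sum>\<beta><N. (residual k v \<alpha> \<beta>)\<^sup>2) = 1 - (\<Sum>a<k. (v a \<alpha>)\<^sup>2)"
proof -
  have "(\<Sum>\<beta><N. (residual k v \<alpha> \<beta>)\<^sup>2) =
      (\<Sum>\<beta><N. (if \<alpha> = \<beta> then 1 else 0) * residual k v \<alpha> \<beta>) -
      (\<Sum>\<beta><N. (\<Sum>a<k. v a \<alpha> * v a \<beta>) * residual k v \<alpha> \<beta>)"
    by (simp add: residual_def power2_eq_square left_diff_distrib flip: sum_subtractf)
  moreover have "(\<Sum>\<beta><N. (\<Sum>a<k. v a \<alpha> * v a \<beta>) * residual k v \<alpha> \<beta>) =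
      (\<Sum>a<k. v a \<alpha> * (\<Sum>\<beta><N. v a \<beta> * residual k v \<alpha> \<beta>))"
    unfolding sum_distrib_left sum_distrib_right by (subst sum.swap) (simp add: mult_ac)
  moreover have "\<dots> = 0"
    using residual_orthogonal[OF assms] by simp
  moreover have "(\<Sum>\<beta><N. (if \<alpha> = \<beta> then 1 else 0) * residual k v \<alpha> \<beta>) = residual k v \<alpha> \<alpha>"
    using assms(2) by (simp add: if_distrib[of "\<lambda>z. z * _"] sum.delta cong: if_cong)
  ultimately show ?thesis
    by (simp add: residual_def power2_eq_square)
qed

lemma sum_residual_norms:
  assumes "orthonormal_family N k v"
  shows "(\<Sum>\<alpha><N. \<Sum>\<beta><N. (residual k v \<alpha> \<beta>)\<^sup>2) = real N - real k"
proof -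
  have "(\<Sum>\<alpha><N. \<Sum>a<k. (v a \<alpha>)\<^sup>2) = (\<Sum>a<k. \<Sum>\<alpha><N. v a \<alpha> * v a \<alpha>)"
    by (subst sum.swap) (simp add: power2_eq_square)
  also have "\<dots> = real k"
    using assms by (simp add: orthonormal_family_def)
  finally show ?thesis
    by (simp add: residual_norm[OF assms] sum_subtractf)
qed

lemma orthonormal_family_le:
  assumes "orthonormal_family N k v"
  shows "k \<le> N"
proof -
  have "0 \<le> (\<Sum>\<alpha><N. \<Sum>\<beta><N. (residual k v \<alpha> \<beta>)\<^sup>2)"
    by (intro sum_nonneg) simp
  then show ?thesis
    by (simp add: sum_residual_norms[OF assms])
qed

text \<open>For \<open>k = N\<close> the residual norms sum to zero, so every residual vanishes.
  This is the passage from U U^T = I to U^T U = I.\<close>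

lemma orthonormal_family_columns:
  assumes "orthonormal_family N N v" "\<alpha> < N" "\<beta> < N"
  shows "(\<Sum>a<N. v a \<alpha> * v a \<beta>) = (if \<alpha> = \<beta> then 1 else 0)"
proof -
  have "\<forall>\<alpha>\<in>{..<N}. (\<Sum>\<beta><N. (residual N v \<alpha> \<beta>)\<^sup>2) = 0"
    using sum_residual_norms[OF assms(1)]
    by (subst (asm) diff_self, subst (asm) sum_nonneg_eq_0_iff) (auto intro: sum_nonneg)
  then have "residual N v \<alpha> \<beta> = 0"
    using assms(2,3) by (auto simp: sum_nonneg_eq_0_iff)
  then show ?thesis
    by (simp add: residual_def)
qed

text \<open>Since the residual norms sum to \<open>N - k > 0\<close>, some residual is nonzero;
  normalised, it becomes the new vector at index \<open>k\<close>.\<close>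

lemma orthonormal_family_extend_one:
  assumes v: "orthonormal_family N k v" and "k < N"
  shows "\<exists>u. orthonormal_family N (Suc k) u \<and> (\<forall>a<k. u a = v a)"
proof -
  have "\<exists>\<alpha><N. 0 < (\<Sum>\<beta><N. (residual k v \<alpha> \<beta>)\<^sup>2)"
  proof (rule ccontr)
    assume "\<not> ?thesis"
    then have "(\<Sum>\<beta><N. (residual k v \<alpha> \<beta>)\<^sup>2) \<le> 0" if "\<alpha> < N" for \<alpha>
      using that by (meson not_less)
    then have "(\<Sum>\<alpha><N. \<Sum>\<beta><N. (residual k v \<alpha> \<beta>)\<^sup>2) \<le> 0"
      by (meson lessThan_iff sum_nonpos)
    with \<open>k < N\<close> show False
      by (simp add: sum_residual_norms[OF v])
  qed
  then obtain \<alpha> where \<alpha>: "\<alpha> < N" "0 < (\<Sum>\<beta><N. (residual k v \<alpha> \<beta>)\<^sup>2)"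
    by blast
  define s where "s = sqrt (\<Sum>\<beta><N. (residual k v \<alpha> \<beta>)\<^sup>2)"
  define r where "r \<beta> = residual k v \<alpha> \<beta> / s" for \<beta>
  define u where "u = v(k := r)"
  have s: "s\<^sup>2 = (\<Sum>\<beta><N. (residual k v \<alpha> \<beta>)\<^sup>2)"
    using \<alpha>(2) by (simp add: s_def)
  have "(\<Sum>\<beta><N. r \<beta> * r \<beta>) = (\<Sum>\<beta><N. (residual k v \<alpha> \<beta>)\<^sup>2) / s\<^sup>2"
    by (simp add: r_def power2_eq_square sum_divide_distrib)
  then have unit: "(\<Sum>\<beta><N. r \<beta> * r \<beta>) = 1"
    using s \<alpha>(2) by simp
  have orth: "(\<Sum>\<beta><N. v a \<beta> * r \<beta>) = 0" if "a < k" for a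
    using residual_orthogonal[OF v \<alpha>(1) that] by (simp add: r_def flip: sum_divide_distrib)
  then have orth': "(\<Sum>\<beta><N. r \<beta> * v a \<beta>) = 0" if "a < k" for a
    using that by (simp add: mult.commute)
  have "orthonormal_family N (Suc k) u"
    using v unit orth orth' by (auto simp: orthonormal_family_def u_def less_Suc_eq)
  then show ?thesis
    by (auto simp: u_def)
qed

lemma orthonormal_family_extend:
  assumes "orthonormal_family N k v"
  shows "\<exists>u. orthonormal_family N N u \<and> (\<forall>a<k. u a = v a)"
proof -
  have "\<exists>u. orthonormal_family N m u \<and> (\<forall>a<k. u a = v a)" if "k \<le> m" "m \<le> N" for m
    using that
  proof (induction m rule: dec_induct)
    case base
    then show ?case
      using assms by blast
  next
    case (step m)
    then obtain u where u: "orthonormal_family N m u" "\<forall>a<k. u a = v a"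
      by auto
    then obtain u' where "orthonormal_family N (Suc m) u'" "\<forall>a<m. u' a = u a"
      using orthonormal_family_extend_one step.prems by (meson Suc_le_lessD)
    with u step.hyps show ?case
      by (metis less_le_trans)
  qed
  then show ?thesis
    using orthonormal_family_le[OF assms] by blast
qed

section \<open>Matrices diagonalised by a common orthogonal matrix\<close>

definition conjugated_diagonal ::
  "nat \<Rightarrow> (nat \<Rightarrow> nat \<Rightarrow> real) \<Rightarrow> (nat \<Rightarrow> real) \<Rightarrow> real mat" where
  "conjugated_diagonal N u t = mat N N (\<lambda>(a, b). \<Sum>\<alpha><N. u a \<alpha> * t \<alpha> * u b \<alpha>)"

text \<open>In U S U^T U T U^T the middle factor U^T U is the identity, by orthonormality of the
  columns. Commutation then reduces to commuting real numbers.\<close>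

lemma conjugated_diagonal_mult:
  assumes "orthonormal_family N N u"
  shows "conjugated_diagonal N u s * conjugated_diagonal N u t =
    conjugated_diagonal N u (\<lambda>\<alpha>. s \<alpha> * t \<alpha>)"
proof (rule eq_matI)
  fix a b
  assume "a < dim_row (conjugated_diagonal N u (\<lambda>\<alpha>. s \<alpha> * t \<alpha>))"
    and "b < dim_col (conjugated_diagonal N u (\<lambda>\<alpha>. s \<alpha> * t \<alpha>))"
  then have ab: "a < N" "b < N"
    by (simp_all add: conjugated_diagonal_def)
  have "(conjugated_diagonal N u s * conjugated_diagonal N u t) $$ (a, b) =
      (\<Sum>c<N. (\<Sum>\<alpha><N. u a \<alpha> * s \<alpha> * u c \<alpha>) * (\<Sum>\<beta><N. u c \<beta> * t \<beta> * u b \<beta>))"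
    using ab by (simp add: conjugated_diagonal_def scalar_prod_def atLeast0LessThan)
  \<comment> \<open>The factors involving \<open>c\<close> are grouped at the end; once its sum is
    innermost, it is the inner product of columns \<open>\<alpha>\<close> and
    \<open>\<beta>\<close>.\<close>
  also have "\<dots> = (\<Sum>c<N. \<Sum>\<alpha><N. \<Sum>\<beta><N.
      u a \<alpha> * s \<alpha> * t \<beta> * u b \<beta> * (u c \<alpha> * u c \<beta>))"
    unfolding sum_product by (simp add: mult_ac)
  also have "\<dots> = (\<Sum>\<alpha><N. \<Sum>c<N. \<Sum>\<beta><N.
      u a \<alpha> * s \<alpha> * t \<beta> * u b \<beta> * (u c \<alpha> * u c \<beta>))"
    by (rule sum.swap)
  also have "\<dots> = (\<Sum>\<alpha><N. \<Sum>\<beta><N. \<Sum>c<N.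
      u a \<alpha> * s \<alpha> * t \<beta> * u b \<beta> * (u c \<alpha> * u c \<beta>))"
    by (intro sum.cong refl sum.swap)
  also have "\<dots> = (\<Sum>\<alpha><N. \<Sum>\<beta><N.
      u a \<alpha> * s \<alpha> * t \<beta> * u b \<beta> * (if \<alpha> = \<beta> then 1 else 0))"
    by (simp add: orthonormal_family_columns[OF assms] flip: sum_distrib_left)
  also have "\<dots> = (\<Sum>\<alpha><N. u a \<alpha> * (s \<alpha> * t \<alpha>) * u b \<alpha>)"
    by (simp add: if_distrib sum.delta mult_ac cong: if_cong)
  finally show "(conjugated_diagonal N u s * conjugated_diagonal N u t) $$ (a, b) =
      conjugated_diagonal N u (\<lambda>\<alpha>. s \<alpha> * t \<alpha>) $$ (a, b)"
    using ab by (simp add: conjugated_diagonal_def)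
qed (simp_all add: conjugated_diagonal_def)

section \<open>Integration of polynomials against the weight\<close>

lemma integrable_weight_mult:
  fixes \<Omega> :: "(real ^ 'd::finite) set"
  assumes "suitable_weight \<Omega> w" "p \<in> poly_space m"
  shows "integrable (lebesgue_on \<Omega>) (\<lambda>x. w x * p x)"
proof (rule Bochner_Integration.integrable_bound)
  have p: "real_polynomial_function p"
    using assms(2) real_polynomial_function_iff_poly_space by blast
  then show "integrable (lebesgue_on \<Omega>) (\<lambda>x. w x * \<bar>p x\<bar>)"
    using assms(1) by (simp add: suitable_weight_def)
  have "continuous_on \<Omega> p"
    by (intro continuous_at_imp_continuous_on ballI continuous_real_polymonial_function p)
  then have "p \<in> borel_measurable (lebesgue_on \<Omega>)"
    using assms(1) by (intro continuous_imp_measurable_on_sets_lebesgue)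
      (simp_all add: suitable_weight_def)
  moreover have "w \<in> borel_measurable (lebesgue_on \<Omega>)"
    using assms(1) by (simp add: suitable_weight_def)
  ultimately show "(\<lambda>x. w x * p x) \<in> borel_measurable (lebesgue_on \<Omega>)"
    by (rule borel_measurable_times[rotated])
qed (simp add: abs_mult)

lemma integrable_weight_mult2:
  fixes \<Omega> :: "(real ^ 'd::finite) set"
  assumes "suitable_weight \<Omega> w" "a \<in> poly_space m" "b \<in> poly_space m'"
  shows "integrable (lebesgue_on \<Omega>) (\<lambda>x. w x * a x * b x)"
  using integrable_weight_mult[OF assms(1) poly_space_mult[OF assms(2,3)]]
  by (simp add: mult.assoc)

lemma poly_space_diff:
  assumes "p \<in> poly_space m" "r \<in> poly_space m"
  shows "(\<lambda>x. p x - r x) \<in> poly_space m"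
proof -
  have "(\<lambda>x. - 1 * r x) \<in> poly_space (0 + m)"
    using poly_space_monomial[of "\<lambda>_. 0" 0 "- 1"] assms(2)
    by (intro poly_space_mult) (simp_all add: monomial_fun_def)
  then show ?thesis
    using poly_space_add[OF assms(1), of "\<lambda>x. - 1 * r x"] by simp
qed

lemma weighted_inner_diff_right:
  fixes \<Omega> :: "(real ^ 'd::finite) set"
  assumes "suitable_weight \<Omega> w" "a \<in> poly_space k" "b \<in> poly_space l" "c \<in> poly_space m"
  shows "weighted_inner \<Omega> w a (\<lambda>x. b x - c x) = weighted_inner \<Omega> w a b - weighted_inner \<Omega> w a c"
  using integrable_weight_mult2[OF assms(1,2,3)] integrable_weight_mult2[OF assms(1,2,4)]
  by (simp add: weighted_inner_def right_diff_distrib)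

lemma weighted_inner_sum_right:
  fixes \<Omega> :: "(real ^ 'd::finite) set"
  assumes "suitable_weight \<Omega> w" "a \<in> poly_space k" "\<And>j. j < n \<Longrightarrow> f j \<in> poly_space m"
  shows "weighted_inner \<Omega> w a (\<lambda>x. \<Sum>j<n. c j * f j x) = (\<Sum>j<n. c j * weighted_inner \<Omega> w a (f j))"
proof -
  have "weighted_inner \<Omega> w a (\<lambda>x. \<Sum>j<n. c j * f j x) =
      (\<integral>x. (\<Sum>j<n. c j * (w x * a x * f j x)) \<partial>lebesgue_on \<Omega>)"
    by (simp add: weighted_inner_def sum_distrib_left mult_ac)
  also have "\<dots> = (\<Sum>j<n. c j * weighted_inner \<Omega> w a (f j))"
    unfolding weighted_inner_def
    using integrable_weight_mult2[OF assms(1,2) assms(3)]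
    by (subst Bochner_Integration.integral_sum) auto
  finally show ?thesis .
qed

lemma weighted_inner_commute: "weighted_inner \<Omega> w a b = weighted_inner \<Omega> w b a"
  by (simp add: weighted_inner_def mult_ac)

section \<open>Orthogonal projection and the operators \<open>chi_op\<close>\<close>

text \<open>\<open>poly_proj\<close> is a definite description, so its properties become available
  only after existence and uniqueness are shown; the orthonormal basis supplies both.\<close>

lemma poly_proj:
  fixes \<Omega> :: "(real ^ 'd::finite) set"
  assumes w: "suitable_weight \<Omega> w" and e: "is_orthonormal_basis \<Omega> w q n e"
    and p: "p \<in> poly_space m"
  shows "poly_proj \<Omega> w q p \<in> poly_space q"
    and "\<And>a. a \<in> poly_space q \<Longrightarrow> weighted_inner \<Omega> w a (\<lambda>x. p x - poly_proj \<Omega> w q p x) = 0"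
proof -
  \<comment> \<open>The candidate is the Fourier sum of \<open>p\<close> in the basis
    \<open>e\<close>.\<close>
  define r where "r = (\<lambda>x. \<Sum>b<n. weighted_inner \<Omega> w (e b) p * e b x)"
  have eq: "e a \<in> poly_space q" if "a < n" for a
    using e that by (simp add: is_orthonormal_basis_def)
  have "(\<lambda>x. c * e a x) \<in> poly_space (0 + q)" if "a < n" for a c
    using poly_space_monomial[of "\<lambda>_. 0" 0 c] eq[OF that]
    by (intro poly_space_mult) (simp_all add: monomial_fun_def)
  then have r: "r \<in> poly_space q"
    unfolding r_def by (intro poly_space_sum) auto
  have pr: "(\<lambda>x. p x - r x) \<in> poly_space (max m q)"
    by (intro poly_space_diff poly_space_mono[OF p] poly_space_mono[OF r]) auto
  have coeff: "weighted_inner \<Omega> w (e a) (\<lambda>x. \<Sum>b<n. c b * e b x) = c a" if "a < n" for a c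
  proof -
    have "weighted_inner \<Omega> w (e a) (\<lambda>x. \<Sum>b<n. c b * e b x) =
        (\<Sum>b<n. c b * weighted_inner \<Omega> w (e a) (e b))"
      using weighted_inner_sum_right[OF w eq[OF that] eq] .
    also have "\<dots> = (\<Sum>b<n. c b * (if a = b then 1 else 0))"
      using e that by (intro sum.cong) (auto simp: is_orthonormal_basis_def)
    also have "\<dots> = c a"
      using that by (simp add: if_distrib sum.delta cong: if_cong)
    finally show ?thesis .
  qed
  \<comment> \<open>\<open>p - r\<close> stands in the first slot so that linearity in the second
    slot extends this from the basis to all of \<open>poly_space q\<close>.\<close>
  have orth_e: "weighted_inner \<Omega> w (\<lambda>x. p x - r x) (e a) = 0" if "a < n" for a
    using weighted_inner_diff_right[OF w eq[OF that] p r] coeff[OF that]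
    by (simp add: r_def weighted_inner_commute[of _ _ _ "e a"])
  have orth: "weighted_inner \<Omega> w a (\<lambda>x. p x - r x) = 0" if a: "a \<in> poly_space q" for a
  proof -
    obtain c where c: "a = (\<lambda>x. \<Sum>b<n. c b * e b x)"
      using e a unfolding is_orthonormal_basis_def by blast
    have "weighted_inner \<Omega> w (\<lambda>x. p x - r x) a =
        (\<Sum>b<n. c b * weighted_inner \<Omega> w (\<lambda>x. p x - r x) (e b))"
      unfolding c using weighted_inner_sum_right[OF w pr eq] .
    also have "\<dots> = 0"
      by (simp add: orth_e)
    finally show ?thesis
      by (simp add: weighted_inner_commute)
  qed
  \<comment> \<open>Testing against \<open>e a\<close> forces each coefficient of \<open>s\<close>
    to be the Fourier coefficient of \<open>p\<close>.\<close>
  have unique: "s = r" if s: "s \<in> poly_space q"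
    and s0: "\<forall>a\<in>poly_space q. weighted_inner \<Omega> w a (\<lambda>x. p x - s x) = 0" for s
  proof -
    obtain c where c: "s = (\<lambda>x. \<Sum>b<n. c b * e b x)"
      using e s unfolding is_orthonormal_basis_def by blast
    have "c a = weighted_inner \<Omega> w (e a) p" if "a < n" for a
      using s0 eq[OF that] weighted_inner_diff_right[OF w eq[OF that] p s] coeff[OF that, of c]
      by (simp add: c)
    then show ?thesis
      by (simp add: c r_def)
  qed
  have "poly_proj \<Omega> w q p = r"
    unfolding poly_proj_def
  proof (rule the_equality)
    show "r \<in> poly_space q \<and> (\<forall>a\<in>poly_space q. weighted_inner \<Omega> w a (\<lambda>x. p x - r x) = 0)"
      using r orth by blast
  qed (use unique in blast)
  then show "poly_proj \<Omega> w q p \<in> poly_space q"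
    and "\<And>a. a \<in> poly_space q \<Longrightarrow> weighted_inner \<Omega> w a (\<lambda>x. p x - poly_proj \<Omega> w q p x) = 0"
    using r orth by simp_all
qed

lemma weighted_inner_chi_op:
  fixes \<Omega> :: "(real ^ 'd::finite) set"
  assumes w: "suitable_weight \<Omega> w" and e: "is_orthonormal_basis \<Omega> w q n e"
    and a: "a \<in> poly_space q" and b: "b \<in> poly_space q"
  shows "weighted_inner \<Omega> w a (chi_op \<Omega> w q i b) = weighted_inner \<Omega> w a (\<lambda>x. x $ i * b x)"
proof -
  have xb: "(\<lambda>x. x $ i * b x) \<in> poly_space (1 + q)"
    using poly_space_mult[OF poly_space_coordinate[of 1 i] b] by simp
  note proj = poly_proj[OF w e xb]
  show ?thesis
    using proj(2)[OF a] weighted_inner_diff_right[OF w a xb proj(1)]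
    by (simp add: chi_op_def)
qed

section \<open>Construction of the extensions from the nodes and weights\<close>

theorem theorem9:
  fixes \<Omega> :: "(real ^ 'd::finite) set"
    and w :: "real ^ 'd \<Rightarrow> real"
    and q n N :: nat
    and e :: "nat \<Rightarrow> real ^ 'd \<Rightarrow> real"
    and A :: "'d \<Rightarrow> real mat"
  assumes "suitable_weight \<Omega> w"
    and "n = (CARD('d) + q) choose CARD('d)"
    and "is_orthonormal_basis \<Omega> w q n e"
    and "\<And>i. A i = mat n n (\<lambda>(a, b). weighted_inner \<Omega> w (e a) (chi_op \<Omega> w q i (e b)))"
    and "\<exists>node weight. is_positive_cubature_rule \<Omega> w (2 * q + 1) N node weight"
  shows "\<exists>A'. symmetric_commuting_extensions n N A A'"
proof -
  obtain node weight where pos: "\<And>\<alpha>. \<alpha> < N \<Longrightarrow> 0 < weight \<alpha>"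
    and exact: "\<And>f. f \<in> poly_space (2 * q + 1) \<Longrightarrow> cubature_exact \<Omega> w N node weight f"
    using assms(5) unfolding is_positive_cubature_rule_def by blast
  have eq: "e a \<in> poly_space q" if "a < n" for a
    using assms(3) that by (simp add: is_orthonormal_basis_def)
  \<comment> \<open>Each weight is split evenly between the two factors of an inner product; the
    square roots multiply back to the weight because it is positive.\<close>
  define v where "v a \<alpha> = sqrt (weight \<alpha>) * e a (node \<alpha>)" for a \<alpha>
  \<comment> \<open>The integrand has degree at most q + 1 + q, exactly the degree of the rule.
    Taking \<open>f\<close> constant gives orthonormality of \<open>v\<close>; taking a coordinate
    gives the entries of \<open>A i\<close>.\<close>
  have discrete: "weighted_inner \<Omega> w (e a) (\<lambda>x. f x * e b x) =
      (\<Sum>\<alpha><N. v a \<alpha> * f (node \<alpha>) * v b \<alpha>)"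
    if "a < n" "b < n" and f: "f \<in> poly_space 1" for a b f
  proof -
    have "(\<lambda>x. e a x * (f x * e b x)) \<in> poly_space (q + (1 + q))"
      using that by (intro poly_space_mult eq)
    then have "cubature_exact \<Omega> w N node weight (\<lambda>x. e a x * (f x * e b x))"
      by (intro exact) (simp add: mult_2 add_ac)
    then have "weighted_inner \<Omega> w (e a) (\<lambda>x. f x * e b x) =
        (\<Sum>\<alpha><N. weight \<alpha> * (e a (node \<alpha>) * (f (node \<alpha>) * e b (node \<alpha>))))"
      by (simp add: cubature_exact_def weighted_inner_def mult.assoc)
    also have "\<dots> = (\<Sum>\<alpha><N. v a \<alpha> * f (node \<alpha>) * v b \<alpha>)"
    proof (intro sum.cong refl)
      fix \<alpha>
      assume "\<alpha> \<in> {..<N}"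
      then have root: "weight \<alpha> = sqrt (weight \<alpha>) * sqrt (weight \<alpha>)"
        using pos by (simp add: less_imp_le)
      show "weight \<alpha> * (e a (node \<alpha>) * (f (node \<alpha>) * e b (node \<alpha>))) =
          v a \<alpha> * f (node \<alpha>) * v b \<alpha>"
        unfolding v_def by (subst root) (simp only: mult_ac)
    qed
    finally show ?thesis .
  qed
  have "(\<lambda>x::real^'d. 1) \<in> poly_space 1"
    using poly_space_monomial[of "\<lambda>_. 0" 1 1] by (simp add: monomial_fun_def)
  from discrete[OF _ _ this] have "orthonormal_family N n v"
    using assms(3) by (simp add: orthonormal_family_def is_orthonormal_basis_def)
  then obtain u where u: "orthonormal_family N N u" and uv: "\<And>a. a < n \<Longrightarrow> u a = v a" and "n \<le> N"
    using orthonormal_family_extend orthonormal_family_le by blast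
  define A' where "A' i = conjugated_diagonal N u (\<lambda>\<alpha>. node \<alpha> $ i)" for i
  \<comment> \<open>Entries in the top left block involve only the rows \<open>u a\<close> with
    \<open>a < n\<close>, which are the original \<open>v a\<close>.\<close>
  have "A' i $$ (a, b) = A i $$ (a, b)" if "a < n" "b < n" for i a b
    using that \<open>n \<le> N\<close> discrete[OF that poly_space_coordinate[of 1 i]]
    by (simp add: A'_def conjugated_diagonal_def assms(4) uv
        weighted_inner_chi_op[OF assms(1,3) eq eq])
  moreover have "A' i * A' j = A' j * A' i" for i j
    by (simp add: A'_def conjugated_diagonal_mult[OF u] mult.commute)
  moreover have "transpose_mat (A' i) = A' i" for i
    by (rule eq_matI) (simp_all add: A'_def conjugated_diagonal_def mult_ac)
  ultimately have "symmetric_commuting_extensions n N A A'"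
    using \<open>n \<le> N\<close>
    by (simp add: symmetric_commuting_extensions_def commuting_extensions_def assms(4)
        A'_def conjugated_diagonal_def)
  then show ?thesis
    by blast
qed

end
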